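(* Let $G$ be an even unicyclic graph on $n$ vertices $1,2,\ldots,n$ with $n$ edges $e_1,e_2,\ldots,e_n$, with cycle $C$ and vertex-edge incidence matrix $M$. Let $H=[h_{i,j}]$ be the $n\times n$ real matrix, with rows indexed by the edges and columns indexed by the vertices of $G$, defined by $$h_{i,j}=\frac{1}{n|C|}\begin{cases}(-1)^{d(e_i,j)}\,|C|\,|G\setminus e_i[C]| & \text{if } e_i\notin C \text{ and } j\in G\setminus e_i(C),\\ (-1)^{d(e_i,j)}\,|C|\,|G\setminus e_i(C)| & \text{if } e_i\notin C \text{ and } j\in G\setminus e_i[C],\\ (-1)^{d_{G\setminus e_i}(r_i,j)}\left(-n\,d_{G\setminus e_i}(r_i,j^* )+\sum_{t\in C} n_t\, d_{G\setminus e_i}(r_i,t)\right) & \text{if } e_i=\{r_i,s_i\}\in C \text{ and } j\in G.\end{cases}$$ Then $H$ is the Moore-Penrose inverse of $M$.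
   Context: A unicyclic graph is a simple connected graph that has a unique cycle as a subgraph; it has as many edges as vertices. It is even if its cycle $C$ has even length. The incidence matrix $M$ of $G$ is the $n\times n$ matrix whose $(i,j)$-entry is $1$ if vertex $i$ is incident with edge $e_j$ and $0$ otherwise. The Moore-Penrose inverse of a real matrix $A$ is the unique real matrix $A^+$ with $AA^+A=A$, $A^+AA^+=A^+$, $(AA^+)^T=AA^+$, $(A^+A)^T=A^+A$. Notation: for a graph $F$, $|F|$ is its number of vertices. Writing $j\in F$ for a vertex $j$ means $j$ is a vertex of $F$; writing $e_i\in C$ (or $e_i \notin C$) for an edge means $e_i$ is (is not) an edge of $C$; sums over $t\in C$ run over the vertices of $C$. $G\setminus e_i$ is the graph obtained from $G$ by deleting the edge $e_i$ (keeping all vertices). For an edge $e_i\notin C$, $G\setminus e_i$ has two connected components: $G\setminus e_i[C]$ is the component containing $C$, and $G\setminus e_i(C)$ is the component not containing $C$. $d(e_i,j)$ is the minimum of the distances in $G$ from vertex $j$ to the two endpoints of $e_i$. For $e_i=\{r_i,s_i\}\in C$, $d_{G\setminus e_i}(x,y)$ is the distance between vertices $x,y$ in the tree $G\setminus e_i$; here $r_i$ denotes a chosen endpoint of $e_i$ (the value of $h_{i,j}$ does not depend on the choice). $j^*$ is the vertex of $C$ closest to vertex $j$ (so $j^*=j$ if $j\in C$). For $t\in C$, $n_t$ is the number of vertices in the tree branch of $G$ starting with $t$, i.e. the number of vertices $k$ of $G$ with $k^*=t$ (including $t$ itself). *)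

theory Defs
  imports "HOL-Analysis.Analysis"
begin

record 'a ugraph =
  verts :: "'a set"
  edges :: "'a set set"

definition simple_graph :: "'a ugraph \<Rightarrow> bool" where
  "simple_graph G \<longleftrightarrow> finite (verts G) \<and> (\<forall>f\<in>edges G. f \<subseteq> verts G \<and> card f = 2)"

definition adj :: "'a ugraph \<Rightarrow> ('a \<times> 'a) set" where
  "adj G = {(u, v). {u, v} \<in> edges G}"

definition connected_graph :: "'a ugraph \<Rightarrow> bool" where
  "connected_graph G \<longleftrightarrow> (\<forall>u\<in>verts G. \<forall>v\<in>verts G. (u, v) \<in> (adj G)\<^sup>*)"

text \<open>A pair lies in the \<open>k\<close>-th relational power of \<^term>\<open>adj G\<close> iff it is joined by a walk
  of length \<open>k\<close>. Only meaningful when the two vertices are in the same component.\<close>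

definition gdist :: "'a ugraph \<Rightarrow> 'a \<Rightarrow> 'a \<Rightarrow> nat" where
  "gdist G u v = (LEAST k. (u, v) \<in> adj G ^^ k)"

definition subgraph :: "'a ugraph \<Rightarrow> 'a ugraph \<Rightarrow> bool" where
  "subgraph F G \<longleftrightarrow> verts F \<subseteq> verts G \<and> edges F \<subseteq> edges G"

definition cycle_graph :: "'a ugraph \<Rightarrow> bool" where
  "cycle_graph C \<longleftrightarrow> (\<exists>p. distinct p \<and> 3 \<le> length p \<and> verts C = set p \<and>
     edges C = {{p ! i, p ! (Suc i mod length p)} | i. i < length p})"

definition unicyclic :: "'a ugraph \<Rightarrow> bool" where
  "unicyclic G \<longleftrightarrow> simple_graph G \<and> connected_graph G \<and> (\<exists>!C. cycle_graph C \<and> subgraph C G)"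

definition even_unicyclic_with_cycle :: "'a ugraph \<Rightarrow> 'a ugraph \<Rightarrow> bool" where
  "even_unicyclic_with_cycle G C \<longleftrightarrow>
     unicyclic G \<and> cycle_graph C \<and> subgraph C G \<and> even (card (edges C))"

definition del_edge :: "'a ugraph \<Rightarrow> 'a set \<Rightarrow> 'a ugraph" where
  "del_edge G f = G\<lparr>edges := edges G - {f}\<rparr>"

text \<open>Connected components are represented by their vertex sets.\<close>

definition components_of :: "'a ugraph \<Rightarrow> 'a set set" where
  "components_of G = {{w \<in> verts G. (v, w) \<in> (adj G)\<^sup>*} | v. v \<in> verts G}"

text \<open>For an edge \<open>f\<close> outside \<open>C\<close>, the components \<open>(G \ f)[C]\<close> and \<open>(G \ f)(C)\<close>.\<close>

definition comp_with_cycle :: "'a ugraph \<Rightarrow> 'a ugraph \<Rightarrow> 'a set \<Rightarrow> 'a set" where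
  "comp_with_cycle G C f = (THE K. K \<in> components_of (del_edge G f) \<and> verts C \<subseteq> K)"

definition comp_without_cycle :: "'a ugraph \<Rightarrow> 'a ugraph \<Rightarrow> 'a set \<Rightarrow> 'a set" where
  "comp_without_cycle G C f = (THE K. K \<in> components_of (del_edge G f) \<and> \<not> verts C \<subseteq> K)"

definition edge_dist :: "'a ugraph \<Rightarrow> 'a set \<Rightarrow> 'a \<Rightarrow> nat" where
  "edge_dist G f j = (MIN x\<in>f. gdist G j x)"

text \<open>The vertex \<open>j\<^sup>*\<close> of \<open>C\<close> closest to \<open>j\<close> (the minimiser is unique in a unicyclic graph),
  and the number \<open>n\<^sub>t\<close> of vertices in the branch at \<open>t\<close>.\<close>

definition cycle_vertex :: "'a ugraph \<Rightarrow> 'a ugraph \<Rightarrow> 'a \<Rightarrow> 'a" where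
  "cycle_vertex G C j = arg_min_on (gdist G j) (verts C)"

definition branch_size :: "'a ugraph \<Rightarrow> 'a ugraph \<Rightarrow> 'a \<Rightarrow> nat" where
  "branch_size G C t = card {k \<in> verts G. cycle_vertex G C k = t}"

text \<open>The type \<open>'n\<close> plays the role of the index set \<open>{1,\<dots>,n}\<close> both for the vertices and for
  the edges \<open>e i\<close>. Rows come first: \<open>A $ i $ j\<close> is the \<open>(i,j)\<close>-entry.\<close>

definition incidence_matrix :: "('n \<Rightarrow> 'n set) \<Rightarrow> real ^ 'n ^ 'n" where
  "incidence_matrix e = (\<chi> j i. if j \<in> e i then 1 else 0)"

text \<open>Here \<open>r i\<close> is the chosen endpoint of a cycle edge \<open>e i\<close>; it is not used for other edges.\<close>

definition H_matrix ::
  "'n ugraph \<Rightarrow> 'n ugraph \<Rightarrow> ('n \<Rightarrow> 'n set) \<Rightarrow> ('n \<Rightarrow> 'n) \<Rightarrow> real ^ 'n ^ 'n" where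
  "H_matrix G C e r = (\<chi> i j. 1 / (real (card (verts G)) * real (card (verts C))) *
     (if e i \<in> edges C then
        (-1) ^ gdist (del_edge G (e i)) (r i) j *
          (- real (card (verts G)) * real (gdist (del_edge G (e i)) (r i) (cycle_vertex G C j))
           + (\<Sum>t\<in>verts C. real (branch_size G C t) * real (gdist (del_edge G (e i)) (r i) t)))
      else if j \<in> comp_without_cycle G C (e i) then
        (-1) ^ edge_dist G (e i) j * real (card (verts C)) * real (card (comp_with_cycle G C (e i)))
      else
        (-1) ^ edge_dist G (e i) j * real (card (verts C)) * real (card (comp_without_cycle G C (e i)))))"

definition moore_penrose_inverse :: "real ^ 'n ^ 'm \<Rightarrow> real ^ 'm ^ 'n \<Rightarrow> bool" where
  "moore_penrose_inverse A X \<longleftrightarrow>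
     A ** X ** A = A \<and> X ** A ** X = X \<and>
     transpose (A ** X) = A ** X \<and> transpose (X ** A) = X ** A"

lemma moore_penrose_inverse_unique:
  assumes "moore_penrose_inverse A X" and "moore_penrose_inverse A Y"
  shows "X = Y"
proof -
  note X = assms(1)[unfolded moore_penrose_inverse_def]
  note Y = assms(2)[unfolded moore_penrose_inverse_def]
  have "A ** X = transpose (A ** Y ** A ** X)"
    using X Y by simp
  also have "\<dots> = transpose (A ** X) ** transpose (A ** Y)"
    by (simp add: matrix_mul_assoc flip: matrix_transpose_mul)
  also have "\<dots> = A ** Y"
    using X Y by (simp add: matrix_mul_assoc)
  finally have AX: "A ** X = A ** Y" .
  have "X ** A = transpose (X ** (A ** Y ** A))"
    using X Y by simp
  also have "\<dots> = transpose (Y ** A) ** transpose (X ** A)"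
    by (simp add: matrix_mul_assoc flip: matrix_transpose_mul)
  also have "\<dots> = Y ** A ** (X ** A)"
    using X Y by simp
  also have "\<dots> = Y ** A"
    using X by (metis matrix_mul_assoc)
  finally have XA: "X ** A = Y ** A" .
  have "X = X ** A ** X" using X by simp
  also have "\<dots> = Y ** (A ** X)" by (simp add: XA matrix_mul_assoc)
  also have "\<dots> = Y ** A ** Y" by (simp add: AX matrix_mul_assoc)
  finally show ?thesis using Y by simp
qed

end

theory Submission
  imports Defs
begin

text \<open>
  An even unicyclic graph \<open>G\<close> is bipartite; let \<open>s\<close> be a 2-colouring of its vertices by signs. Every
  edge joins opposite signs, so \<open>s\<close> spans the left kernel of the incidence matrix \<open>M\<close>. The right
  kernel is spanned by the vector that alternates between \<open>1\<close> and \<open>-1\<close> along \<open>C\<close> and vanishes off \<open>C\<close>.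
  So \<open>M M\<^sup>+\<close> and \<open>M\<^sup>+ M\<close> have to be the orthogonal projections along these two kernels, and \<open>M H\<close> and
  \<open>H M\<close> turn out to be exactly those.

  All signs in \<open>H\<close> come from \<open>s\<close>: a walk of length \<open>k\<close> from \<open>u\<close> to \<open>v\<close> gives \<open>s v = (-1)\<^sup>k s u\<close>. Divided
  by \<open>s j\<close>, the entries of a row \<open>i\<close> of \<open>H\<close> become a function \<open>g\<close> of the vertex \<open>j\<close>, and the
  entry of \<open>H M\<close> at \<open>(i, k)\<close> is, up to sign, the difference of \<open>g\<close> across the edge \<open>e k\<close>.

  \<^item> If \<open>e i\<close> is off the cycle it is a bridge, and \<open>g\<close> is constant on each of the two components of
    \<open>G\<close> without \<open>e i\<close>. Only the edge \<open>e i\<close> itself sees a difference, which the normalisation makes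
    equal to \<open>1\<close> (\<open>HM_bridge_row\<close>).
  \<^item> If \<open>e i\<close> lies on the cycle then, up to a sign and a positive factor, \<open>g\<close> is a constant minus
    \<open>n\<close> times the position of \<open>j\<^sup>*\<close> on the path that remains of \<open>C\<close> after deleting \<open>e i\<close>. This
    position does not change across edges off the cycle, changes by one across every other cycle edge,
    and by \<open>|C| - 1\<close> across \<open>e i\<close>. So \<open>|C| (H M - I)\<close> has an alternating sign vector around \<open>C\<close> as
    its row \<open>i\<close> (\<open>dev_cycle\<close>).

  The constants in \<open>H\<close> are such that \<open>H s = 0\<close> (\<open>H_colouring_zero\<close>). The rows of \<open>H M - I\<close> are in the
  right kernel of \<open>M\<close> and the matrix is symmetric (\<open>dev_kernel\<close>, \<open>dev_sym\<close>), so \<open>M H M = M\<close>. Then each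
  row of \<open>M H - I\<close> is in the left kernel of \<open>M\<close>; together with \<open>H s = 0\<close> this forces
  \<open>M H = I - s s\<^sup>T / n\<close> (\<open>MH_eq\<close>), which is symmetric and gives \<open>H M H = H\<close>.

  The graph theory behind this rests on one construction, \<open>nonbridge_cycle\<close>: a shortest walk between the
  ends of an edge that avoids the edge closes up to a cycle. By uniqueness that cycle is \<open>C\<close>. Hence edges
  off \<open>C\<close> are bridges, and the vertices of \<open>C\<close> can be listed so that the distances in \<open>G\<close> without a
  cycle edge are the positions in the list.
\<close>

section \<open>Walks and distances\<close>

lemma sym_adj: "sym (adj G)"
  by (auto simp: sym_def adj_def insert_commute)

lemma connected_sym: "(u, v) \<in> (adj G)\<^sup>* \<Longrightarrow> (v, u) \<in> (adj G)\<^sup>*"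
  by (rule symD[OF sym_rtrancl[OF sym_adj]])

lemma adj_del_edge: "(u, v) \<in> adj (del_edge G f) \<longleftrightarrow> (u, v) \<in> adj G \<and> {u, v} \<noteq> f"
  by (auto simp: adj_def del_edge_def)

lemma edges_del_edge [simp]: "edges (del_edge G f) = edges G - {f}"
  and verts_del_edge [simp]: "verts (del_edge G f) = verts G"
  by (auto simp: del_edge_def)

lemma gdist_walk: "(u, v) \<in> (adj G)\<^sup>* \<Longrightarrow> (u, v) \<in> adj G ^^ gdist G u v"
  unfolding gdist_def by (auto simp: rtrancl_power intro: LeastI)

lemma gdist_le: "(u, v) \<in> adj G ^^ k \<Longrightarrow> gdist G u v \<le> k"
  unfolding gdist_def by (rule Least_le)

lemma walk_segment:
  assumes "\<And>i. i < n \<Longrightarrow> (f i, f (Suc i)) \<in> R" and "i \<le> j" "j \<le> n"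
  shows "(f i, f j) \<in> R ^^ (j - i)"
proof -
  have "\<forall>k<j - i. (f (i + k), f (i + Suc k)) \<in> R"
    using assms by auto
  then show ?thesis
    using assms(2) unfolding relpow_fun_conv by (intro exI[of _ "\<lambda>k. f (i + k)"]) auto
qed

lemma walk_connected:
  assumes "\<And>i. i < n \<Longrightarrow> (f i, f (Suc i)) \<in> R" and "i \<le> j" "j \<le> n"
  shows "(f i, f j) \<in> R\<^sup>*"
  using walk_segment[of n f R, OF assms] by (rule relpow_imp_rtrancl)

lemma shortest_walk:
  assumes "(u, v) \<in> (adj G)\<^sup>*"
  obtains f where "f 0 = u" "f (gdist G u v) = v"
    "\<And>i. i < gdist G u v \<Longrightarrow> (f i, f (Suc i)) \<in> adj G"
    "\<And>i. i \<le> gdist G u v \<Longrightarrow> gdist G u (f i) = i"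
proof -
  let ?n = "gdist G u v"
  obtain f where f: "f 0 = u" "f ?n = v" and step: "\<And>i. i < ?n \<Longrightarrow> (f i, f (Suc i)) \<in> adj G"
    using gdist_walk[OF assms] unfolding relpow_fun_conv by blast
  have "gdist G u (f i) = i" if "i \<le> ?n" for i
  proof -
    have ui: "(u, f i) \<in> adj G ^^ i"
      using walk_segment[of ?n f "adj G" 0 i] step that f by auto
    have "(f i, v) \<in> adj G ^^ (?n - i)"
      using walk_segment[of ?n f "adj G" i ?n] step that f by auto
    with gdist_walk[OF relpow_imp_rtrancl[OF ui]]
    have "(u, v) \<in> adj G ^^ (gdist G u (f i) + (?n - i))"
      by (auto simp: relpow_add)
    from gdist_le[OF this] gdist_le[OF ui] that show ?thesis by simp
  qed
  with f step that show thesis by blast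
qed

lemma gdist_adj_le:
  assumes "(r, u) \<in> (adj G)\<^sup>*" "(u, v) \<in> adj G"
  shows "gdist G r v \<le> Suc (gdist G r u)"
  using gdist_walk[OF assms(1)] assms(2) by (intro gdist_le) auto

text \<open>Distances from \<open>j\<close> increase strictly along a shortest walk from \<open>j\<close> to \<open>y\<close>, so the walk cannot enter
  \<open>y\<close> from a vertex that is at least as far away as \<open>y\<close>.\<close>

lemma nearer_endpoint_avoids_edge:
  assumes "(j, y) \<in> (adj G)\<^sup>*" and le: "gdist G j y \<le> gdist G j x"
  shows "(j, y) \<in> (adj (del_edge G {x, y}))\<^sup>*"
proof -
  obtain f where f: "f 0 = j" "f (gdist G j y) = y"
    and step: "\<And>i. i < gdist G j y \<Longrightarrow> (f i, f (Suc i)) \<in> adj G"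
    and d: "\<And>i. i \<le> gdist G j y \<Longrightarrow> gdist G j (f i) = i"
    using shortest_walk[OF assms(1)] by blast
  have "(f i, f (Suc i)) \<in> adj (del_edge G {x, y})" if i: "i < gdist G j y" for i
  proof -
    have "f i \<noteq> y" using d[of i] i by auto
    moreover have "f i \<noteq> x" using d[of i] i le by auto
    ultimately show ?thesis
      using step[OF i] by (auto simp: adj_del_edge doubleton_eq_iff)
  qed
  from walk_connected[of "gdist G j y" f, OF this, of 0 "gdist G j y"] show ?thesis
    using f by simp
qed

text \<open>Cut a walk from \<open>a\<close> to \<open>b\<close> at its last visit to \<open>a\<close>. The rest of the walk then avoids every edge
  at \<open>a\<close>.\<close>

lemma last_departure:
  assumes "(a, b) \<in> R\<^sup>*" "a \<noteq> b"
  obtains y where "(a, y) \<in> R" "(y, b) \<in> {(p, q) \<in> R. p \<noteq> a \<and> q \<noteq> a}\<^sup>*"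
proof -
  let ?S = "{(p, q) \<in> R. p \<noteq> a \<and> q \<noteq> a}"
  have "a \<noteq> b \<longrightarrow> (\<exists>y. (a, y) \<in> R \<and> (y, b) \<in> ?S\<^sup>*)"
    using assms(1)
  proof (induction rule: rtrancl_induct)
    case (step b c)
    show ?case
    proof (intro impI)
      assume "a \<noteq> c"
      show "\<exists>y. (a, y) \<in> R \<and> (y, c) \<in> ?S\<^sup>*"
      proof (cases "a = b")
        case False
        then obtain y where y: "(a, y) \<in> R" "(y, b) \<in> ?S\<^sup>*" using step.IH by blast
        have "(b, c) \<in> ?S" using step.hyps False \<open>a \<noteq> c\<close> by auto
        with y show ?thesis by (meson rtrancl.rtrancl_into_rtrancl)
      qed (use step.hyps in blast)
    qed
  qed simp
  with assms(2) that show thesis by blast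
qed

section \<open>Cycles\<close>

text \<open>Cycles are handled through a cyclic list of their vertices, so that edges have positions.\<close>

definition cyc_edge :: "'a list \<Rightarrow> nat \<Rightarrow> 'a set" where
  "cyc_edge q m = {q ! m, q ! (Suc m mod length q)}"

definition lists_cycle :: "'a list \<Rightarrow> 'a ugraph \<Rightarrow> bool" where
  "lists_cycle q C \<longleftrightarrow> distinct q \<and> 3 \<le> length q \<and> verts C = set q \<and>
     edges C = cyc_edge q ` {..<length q}"

lemma cycle_graph_iff: "cycle_graph C \<longleftrightarrow> (\<exists>q. lists_cycle q C)"
  unfolding cycle_graph_def lists_cycle_def cyc_edge_def image_def by fastforce

text \<open>This needs length at least three: on a cyclic list of length two both positions give the same edge.\<close>

lemma inj_on_cyc_edge:
  assumes "distinct q" "3 \<le> length q"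
  shows "inj_on (cyc_edge q) {..<length q}"
proof (rule inj_onI)
  fix a b assume ab: "a \<in> {..<length q}" "b \<in> {..<length q}" and eq: "cyc_edge q a = cyc_edge q b"
  let ?L = "length q"
  have sa: "Suc a mod ?L = (if Suc a = ?L then 0 else Suc a)"
    and sb: "Suc b mod ?L = (if Suc b = ?L then 0 else Suc b)"
    using ab by auto
  have *: "Suc a mod ?L < ?L" "Suc b mod ?L < ?L" using assms ab by (auto simp: sa sb)
  show "a = b"
    using eq ab assms * unfolding cyc_edge_def
    by (auto simp: doubleton_eq_iff nth_eq_iff_index_eq sa sb split: if_splits)
qed

lemma lists_cycle_card:
  assumes "lists_cycle q C"
  shows "card (verts C) = length q" "card (edges C) = length q"
  using assms inj_on_cyc_edge[of q]
  by (auto simp: lists_cycle_def distinct_card card_image)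

lemma mod_Suc_neq: "3 \<le> L \<Longrightarrow> m < L \<Longrightarrow> Suc m mod L \<noteq> (m::nat)"
  by (cases "Suc m = L") auto

lemma cycle_connected:
  assumes "lists_cycle q C" "edges C \<subseteq> edges H" "u \<in> verts C" "v \<in> verts C"
  shows "(u, v) \<in> (adj H)\<^sup>*"
proof -
  have step: "(q ! i, q ! Suc i) \<in> adj H" if "i < length q - 1" for i
  proof -
    have "cyc_edge q i \<in> edges C" using assms(1) that by (auto simp: lists_cycle_def)
    moreover have "cyc_edge q i = {q ! i, q ! Suc i}" using that by (auto simp: cyc_edge_def)
    ultimately show ?thesis using assms(2) by (auto simp: adj_def)
  qed
  have "(q ! 0, w) \<in> (adj H)\<^sup>*" if w: "w \<in> verts C" for w
  proof -
    obtain i where "i < length q" "w = q ! i"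
      using w assms(1) by (auto simp: lists_cycle_def in_set_conv_nth)
    then show ?thesis using walk_connected[of "length q - 1" "(!) q" "adj H" 0 i] step by auto
  qed
  then show ?thesis using assms(3,4) by (meson connected_sym rtrancl_trans)
qed

text \<open>Walk around the cycle the other way.\<close>

lemma cycle_minus_edge_connected:
  assumes q: "lists_cycle q C" and sub: "edges C \<subseteq> edges H" and uv: "{u, v} \<in> edges C"
  shows "(u, v) \<in> (adj (del_edge H {u, v}))\<^sup>*"
proof -
  let ?L = "length q"
  obtain a where a: "a < ?L" "{u, v} = cyc_edge q a" using q uv by (auto simp: lists_cycle_def)
  \<comment> \<open>The long way round, from the second end of the deleted edge to its first end.\<close>
  define f where "f k = q ! ((Suc a + k) mod ?L)" for k
  have step: "(f k, f (Suc k)) \<in> adj (del_edge H {u, v})" if k: "k < ?L - 1" for k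
  proof -
    let ?b = "(Suc a + k) mod ?L"
    have b: "?b < ?L" using a by (intro mod_less_divisor) linarith
    have "?b \<noteq> a"
    proof (cases "Suc a + k < ?L")
      case False
      then have "?b = Suc a + k - ?L" using a k by (simp add: mod_if)
      then show ?thesis using a k False by linarith
    qed auto
    then have "cyc_edge q ?b \<noteq> cyc_edge q a"
      using inj_on_cyc_edge[of q] a b q by (auto simp: lists_cycle_def inj_on_def)
    moreover have "cyc_edge q ?b = {f k, f (Suc k)}"
      by (simp add: cyc_edge_def f_def mod_Suc_eq)
    moreover have "cyc_edge q ?b \<in> edges H" using q b sub by (auto simp: lists_cycle_def)
    ultimately show ?thesis using a by (simp add: adj_del_edge adj_def)
  qed
  have "(f 0, f (?L - 1)) \<in> (adj (del_edge H {u, v}))\<^sup>*"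
    using walk_connected[of "?L - 1" f, OF step] by auto
  moreover have "f 0 = q ! (Suc a mod ?L)" by (simp add: f_def)
  moreover have "f (?L - 1) = q ! a"
  proof -
    have "Suc a + (?L - 1) = a + ?L" using a by simp
    then show ?thesis using a by (simp add: f_def)
  qed
  ultimately have "(q ! (Suc a mod ?L), q ! a) \<in> (adj (del_edge H {u, v}))\<^sup>*" by simp
  moreover from this have "(q ! a, q ! (Suc a mod ?L)) \<in> (adj (del_edge H {u, v}))\<^sup>*"
    by (rule connected_sym)
  moreover have "u = q ! a \<and> v = q ! (Suc a mod ?L) \<or> u = q ! (Suc a mod ?L) \<and> v = q ! a"
    using a(2) by (simp add: cyc_edge_def doubleton_eq_iff)
  ultimately show ?thesis by blast
qed

text \<open>A shortest walk from \<open>u\<close> to \<open>v\<close> that avoids the edge \<open>{u, v}\<close> repeats no vertex and has length at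
  least two, so the edge closes it to a cycle. The listing keeps the distances from \<open>u\<close>, because later
  they are read off as positions on the unique cycle.\<close>

lemma nonbridge_cycle:
  assumes simple: "simple_graph H" and uv: "{u, v} \<in> edges H"
    and con: "(u, v) \<in> (adj (del_edge H {u, v}))\<^sup>*"
  obtains q D where "lists_cycle q D" "subgraph D H" "q ! 0 = u" "q ! (length q - 1) = v"
    "\<And>m. m < length q \<Longrightarrow> gdist (del_edge H {u, v}) u (q ! m) = m"
proof -
  let ?T = "del_edge H {u, v}"
  let ?n = "gdist ?T u v"
  obtain f where f: "f 0 = u" "f ?n = v"
    and step: "\<And>i. i < ?n \<Longrightarrow> (f i, f (Suc i)) \<in> adj ?T"
    and d: "\<And>i. i \<le> ?n \<Longrightarrow> gdist ?T u (f i) = i"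
    using shortest_walk[OF con] by blast
  have "u \<noteq> v" using simple uv by (auto simp: simple_graph_def)
  then have "?n \<noteq> 0" using f by metis
  moreover have "?n \<noteq> 1" using step[of 0] f by (auto simp: adj_del_edge)
  ultimately have n: "2 \<le> ?n" by linarith
  define q where "q = map f [0..<Suc ?n]"
  have len: "length q = Suc ?n" by (simp add: q_def)
  have nth: "q ! m = f m" if "m \<le> ?n" for m
    using that unfolding q_def by (subst nth_map) (auto simp del: upt_Suc)
  have "inj_on f {0..<Suc ?n}"
  proof (rule inj_onI)
    fix a b assume "a \<in> {0..<Suc ?n}" "b \<in> {0..<Suc ?n}" and eq: "f a = f b"
    then have "a \<le> ?n" "b \<le> ?n" by auto
    from d[OF this(1)] d[OF this(2)] show "a = b" unfolding eq by (rule trans[OF sym])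
  qed
  then have dist: "distinct q" by (simp add: q_def distinct_map del: upt_Suc)
  have edge: "cyc_edge q m \<in> edges H" if "m \<le> ?n" for m
  proof (cases "m = ?n")
    case True
    then show ?thesis using uv f nth len by (simp add: cyc_edge_def insert_commute)
  next
    case False
    then show ?thesis using step[of m] nth that len by (auto simp: cyc_edge_def adj_def)
  qed
  define D where "D = \<lparr>verts = set q, edges = cyc_edge q ` {..<length q}\<rparr>"
  have "lists_cycle q D" using dist len n by (simp add: lists_cycle_def D_def)
  moreover have "subgraph D H"
  proof -
    have E: "edges D \<subseteq> edges H" using edge len by (auto simp: D_def)
    have "q ! m \<in> verts H" if "m < length q" for m
      using edge[of m] simple that len by (auto simp: simple_graph_def cyc_edge_def)
    then have "verts D \<subseteq> verts H" by (auto simp: D_def in_set_conv_nth)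
    with E show ?thesis by (simp add: subgraph_def)
  qed
  moreover have "q ! 0 = u" "q ! (length q - 1) = v"
    using nth[of 0] nth[of ?n] f len by auto
  moreover have "gdist ?T u (q ! m) = m" if "m < length q" for m
  proof -
    have m: "m \<le> ?n" using that len by simp
    show ?thesis unfolding nth[OF m] by (rule d[OF m])
  qed
  ultimately show thesis by (rule that)
qed

section \<open>Even unicyclic graphs\<close>

locale even_unicyclic =
  fixes G C :: "'a ugraph"
  assumes even_unicyclic_G: "even_unicyclic_with_cycle G C"
begin

lemma simple: "simple_graph G"
  and connected: "connected_graph G"
  and sub: "subgraph C G"
  using even_unicyclic_G by (auto simp: even_unicyclic_with_cycle_def unicyclic_def)

lemma cycle_unique: "lists_cycle q D \<Longrightarrow> subgraph D G \<Longrightarrow> D = C"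
  using even_unicyclic_G by (auto simp: even_unicyclic_with_cycle_def unicyclic_def cycle_graph_iff)

lemma edge_ends: "f \<in> edges G \<Longrightarrow> \<exists>u v. f = {u, v} \<and> u \<noteq> v"
  using simple by (auto simp: simple_graph_def card_2_iff)

lemma cycle_edges: "edges C \<subseteq> edges G"
  using sub by (simp add: subgraph_def)

lemma some_listing: "\<exists>q. lists_cycle q C"
  using even_unicyclic_G by (simp add: even_unicyclic_with_cycle_def cycle_graph_iff)

lemma cycle_edge_verts:
  assumes "f \<in> edges C"
  shows "f \<subseteq> verts C"
proof -
  obtain q where q: "lists_cycle q C" using some_listing by blast
  then obtain i where i: "i < length q" "f = cyc_edge q i"
    using assms by (auto simp: lists_cycle_def)
  have "Suc i mod length q < length q" using i by (intro mod_less_divisor) linarith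
  then show ?thesis using q i by (auto simp: lists_cycle_def cyc_edge_def)
qed

lemma cycle_len: "even (card (verts C))" "3 \<le> card (verts C)"
  using even_unicyclic_G some_listing lists_cycle_card[of _ C]
  by (auto simp: even_unicyclic_with_cycle_def lists_cycle_def)

lemma noncycle_edge_bridge:
  assumes "{u, v} \<in> edges G" "{u, v} \<notin> edges C"
  shows "(u, v) \<notin> (adj (del_edge G {u, v}))\<^sup>*"
proof
  assume "(u, v) \<in> (adj (del_edge G {u, v}))\<^sup>*"
  then obtain q D where q: "lists_cycle q D" "subgraph D G" "q ! 0 = u" "q ! (length q - 1) = v"
    using nonbridge_cycle[OF simple assms(1)] by metis
  have "cyc_edge q (length q - 1) \<in> edges D" using q(1) by (auto simp: lists_cycle_def)
  moreover have "cyc_edge q (length q - 1) = {u, v}"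
  proof -
    have "Suc (length q - 1) = length q" using q(1) by (auto simp: lists_cycle_def)
    then show ?thesis using q(3,4) unfolding cyc_edge_def by (simp only: mod_self insert_commute)
  qed
  ultimately show False using cycle_unique[OF q(1,2)] assms by simp
qed

lemma cycle_listing:
  assumes "{r, s} \<in> edges C"
  obtains q where "lists_cycle q C" "q ! 0 = r" "q ! (length q - 1) = s"
    "\<And>m. m < length q \<Longrightarrow> gdist (del_edge G {r, s}) r (q ! m) = m"
proof -
  obtain p where p: "lists_cycle p C" using some_listing by blast
  have con: "(r, s) \<in> (adj (del_edge G {r, s}))\<^sup>*"
    using cycle_minus_edge_connected[OF p cycle_edges assms] .
  have rs: "{r, s} \<in> edges G" using assms cycle_edges by blast
  show thesis
  proof (rule nonbridge_cycle[OF simple rs con])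
    fix q D
    assume "lists_cycle q D" "subgraph D G" "q ! 0 = r" "q ! (length q - 1) = s"
      "\<And>m. m < length q \<Longrightarrow> gdist (del_edge G {r, s}) r (q ! m) = m"
    with cycle_unique[of q D] that[of q] show thesis by simp
  qed
qed

lemma del_cycle_edge_connected:
  assumes f: "f \<in> edges C" and uv: "u \<in> verts G" "v \<in> verts G"
  shows "(u, v) \<in> (adj (del_edge G f))\<^sup>*"
proof -
  obtain p where p: "lists_cycle p C" using some_listing by blast
  have "adj G \<subseteq> (adj (del_edge G f))\<^sup>*"
  proof
    fix x assume x: "x \<in> adj G"
    obtain a b where ab: "x = (a, b)" by (cases x)
    show "x \<in> (adj (del_edge G f))\<^sup>*"
    proof (cases "{a, b} = f")
      case True
      then show ?thesis using cycle_minus_edge_connected[OF p cycle_edges, of a b] f ab by auto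
    next
      case False
      then show ?thesis using x ab by (auto simp: adj_del_edge)
    qed
  qed
  then have "(adj G)\<^sup>* \<subseteq> (adj (del_edge G f))\<^sup>*"
    by (rule rtrancl_subset_rtrancl)
  then show ?thesis using connected uv by (auto simp: connected_graph_def)
qed

text \<open>Delete a cycle edge \<open>{a, b}\<close> and colour by the parity of the distance from \<open>a\<close>. If the ends of a
  remaining edge had equal distance, shortest walks to both would avoid that edge, which would then lie on a
  cycle other than \<open>C\<close>. The deleted edge is coloured properly because \<open>a\<close> and \<open>b\<close> are at distance
  \<open>|C| - 1\<close>, which is odd.\<close>

lemma two_colouring:
  obtains s :: "'a \<Rightarrow> real" where "\<And>u. s u * s u = 1" "\<And>u v. (u, v) \<in> adj G \<Longrightarrow> s v = - s u"
proof -
  obtain p where p: "lists_cycle p C" using some_listing by blast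
  then have "cyc_edge p 0 \<in> edges C" by (auto simp: lists_cycle_def)
  then obtain a b where ab: "{a, b} \<in> edges C" unfolding cyc_edge_def by blast
  let ?T = "del_edge G {a, b}"
  obtain q where q: "lists_cycle q C" "q ! 0 = a" "q ! (length q - 1) = b"
    and d: "\<And>m. m < length q \<Longrightarrow> gdist ?T a (q ! m) = m"
    using cycle_listing[OF ab] by blast
  have L: "even (length q)" "3 \<le> length q" using cycle_len lists_cycle_card[OF q(1)] by auto
  have da: "gdist ?T a a = 0" and db: "gdist ?T a b = length q - 1"
    using d[of 0] d[of "length q - 1"] L(2) q by (auto simp del: length_greater_0_conv)
  define s :: "'a \<Rightarrow> real" where "s u = (- 1) ^ gdist ?T a u" for u
  have a: "a \<in> verts G" using ab cycle_edge_verts sub by (auto simp: subgraph_def)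
  have flip: "s v = - s u" if uv: "(u, v) \<in> adj G" for u v
  proof (cases "{u, v} = {a, b}")
    case True
    have "s b = - s a" using L by (auto simp: s_def da db)
    then show ?thesis using True by (auto simp: doubleton_eq_iff)
  next
    case False
    have uvT: "(u, v) \<in> adj ?T" "(v, u) \<in> adj ?T"
      using uv False by (auto simp: adj_del_edge adj_def insert_commute)
    have "{u, v} \<subseteq> verts G" using uv simple by (auto simp: adj_def simple_graph_def)
    then have con: "(a, u) \<in> (adj ?T)\<^sup>*" "(a, v) \<in> (adj ?T)\<^sup>*"
      using del_cycle_edge_connected[OF ab a] by auto
    have "gdist ?T a u \<noteq> gdist ?T a v"
    proof
      assume eq: "gdist ?T a u = gdist ?T a v"
      let ?U = "del_edge ?T {u, v}"
      have "(a, v) \<in> (adj ?U)\<^sup>*" "(a, u) \<in> (adj ?U)\<^sup>*"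
        using nearer_endpoint_avoids_edge[OF con(1), of v] nearer_endpoint_avoids_edge[OF con(2), of u] eq
        by (auto simp: insert_commute)
      then have "(u, v) \<in> (adj ?U)\<^sup>*" by (meson connected_sym rtrancl_trans)
      moreover have "simple_graph ?T" using simple by (simp add: simple_graph_def)
      moreover have "{u, v} \<in> edges ?T" using uvT by (simp add: adj_def)
      ultimately obtain q' D where D: "lists_cycle q' D" "subgraph D ?T"
        using nonbridge_cycle[of ?T u v] by metis
      then have "D = C" by (intro cycle_unique) (auto simp: subgraph_def)
      then show False using D ab by (auto simp: subgraph_def)
    qed
    moreover have "gdist ?T a v \<le> Suc (gdist ?T a u)" "gdist ?T a u \<le> Suc (gdist ?T a v)"
      using gdist_adj_le con uvT by metis+
    ultimately have "gdist ?T a v = Suc (gdist ?T a u) \<or> gdist ?T a u = Suc (gdist ?T a v)"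
      by linarith
    then show ?thesis by (auto simp: s_def)
  qed
  have "s u * s u = 1" for u by (simp add: s_def flip: power_mult_distrib)
  with flip that show thesis by blast
qed

text \<open>The branches at different cycle vertices are disjoint. Otherwise leave \<open>a\<close> for the last time on a walk off
  the cycle, by an edge \<open>{a, y}\<close>, go on to \<open>b\<close> and come back to \<open>a\<close> along the cycle. This joins the ends
  of \<open>{a, y}\<close> without using it, although it is a bridge.\<close>

lemma noncycle_connected_imp_eq:
  assumes ab: "a \<in> verts C" "b \<in> verts C"
    and con: "(a, b) \<in> {(u, v) \<in> adj G. {u, v} \<notin> edges C}\<^sup>*" (is "_ \<in> ?F\<^sup>*")
  shows "a = b"
proof (rule ccontr)
  assume "a \<noteq> b"
  obtain p where p: "lists_cycle p C" using some_listing by blast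
  from con \<open>a \<noteq> b\<close> obtain y where y: "(a, y) \<in> ?F"
    and yb: "(y, b) \<in> {(p, q) \<in> ?F. p \<noteq> a \<and> q \<noteq> a}\<^sup>*" by (rule last_departure)
  let ?T = "del_edge G {a, y}"
  have "{(p, q) \<in> ?F. p \<noteq> a \<and> q \<noteq> a} \<subseteq> adj ?T"
    by (auto simp: adj_del_edge doubleton_eq_iff)
  then have "(y, b) \<in> (adj ?T)\<^sup>*" using yb rtrancl_mono by blast
  moreover have "edges C \<subseteq> edges ?T" using cycle_edges y by auto
  then have "(a, b) \<in> (adj ?T)\<^sup>*" by (rule cycle_connected[OF p _ ab])
  ultimately have "(a, y) \<in> (adj ?T)\<^sup>*" by (meson connected_sym rtrancl_trans)
  then show False using noncycle_edge_bridge[of a y] y by (auto simp: adj_def)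
qed

text \<open>A shortest walk from \<open>j\<close> to the cycle meets the cycle only at its end, so it uses no cycle edge.
  As branches are disjoint, \<open>j\<^sup>*\<close> is the only cycle vertex in the component of \<open>j\<close> after deleting all
  edges of \<open>C\<close>; so \<open>j\<^sup>*\<close> can be handled without comparing distances.\<close>

lemma cycle_vertex_reach:
  assumes j: "j \<in> verts G"
  shows "cycle_vertex G C j \<in> verts C"
    "(j, cycle_vertex G C j) \<in> {(u, v) \<in> adj G. {u, v} \<notin> edges C}\<^sup>*"
proof -
  let ?c = "cycle_vertex G C j"
  have fin: "finite (verts C)" "verts C \<noteq> {}" using cycle_len(2) card.infinite by fastforce+
  show c: "?c \<in> verts C"
    unfolding cycle_vertex_def using fin by (rule arg_min_if_finite)
  have least: "gdist G j ?c \<le> gdist G j t" if "t \<in> verts C" for t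
    unfolding cycle_vertex_def using fin that by (rule arg_min_least)
  have "(j, ?c) \<in> (adj G)\<^sup>*" using connected j c sub by (auto simp: connected_graph_def subgraph_def)
  from shortest_walk[OF this] obtain f where f: "f 0 = j" "f (gdist G j ?c) = ?c"
    and step: "\<And>i. i < gdist G j ?c \<Longrightarrow> (f i, f (Suc i)) \<in> adj G"
    and d: "\<And>i. i \<le> gdist G j ?c \<Longrightarrow> gdist G j (f i) = i"
    by blast
  have "(f i, f (Suc i)) \<in> {(u, v) \<in> adj G. {u, v} \<notin> edges C}" if i: "i < gdist G j ?c" for i
  proof -
    have "gdist G j (f i) < gdist G j ?c" using d[of i] i by linarith
    then have "f i \<notin> verts C" using least[of "f i"] by linarith
    then show ?thesis using step[OF i] cycle_edge_verts by auto
  qed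
  from walk_connected[of "gdist G j ?c" f, OF this, of 0 "gdist G j ?c"]
  show "(j, ?c) \<in> {(u, v) \<in> adj G. {u, v} \<notin> edges C}\<^sup>*" using f by simp
qed

lemma sym_noncycle: "sym ({(u, v) \<in> adj G. {u, v} \<notin> edges C}\<^sup>*)"
  by (intro sym_rtrancl) (auto simp: sym_def adj_def insert_commute)

lemma cycle_vertex_cycle: "j \<in> verts C \<Longrightarrow> cycle_vertex G C j = j"
  using noncycle_connected_imp_eq[of j "cycle_vertex G C j"] cycle_vertex_reach[of j] sub
  by (auto simp: subgraph_def)

lemma cycle_vertex_noncycle_edge:
  assumes "(u, v) \<in> adj G" "{u, v} \<notin> edges C"
  shows "cycle_vertex G C u = cycle_vertex G C v"
proof -
  have "{u, v} \<subseteq> verts G" using assms simple by (auto simp: adj_def simple_graph_def)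
  then have *: "u \<in> verts G" "v \<in> verts G" by auto
  let ?F = "{(u, v) \<in> adj G. {u, v} \<notin> edges C}"
  have "(cycle_vertex G C u, u) \<in> ?F\<^sup>*"
    using cycle_vertex_reach(2)[OF *(1)] sym_noncycle by (auto dest: symD)
  moreover have "(u, v) \<in> ?F\<^sup>*" using assms by auto
  ultimately have "(cycle_vertex G C u, cycle_vertex G C v) \<in> ?F\<^sup>*"
    using cycle_vertex_reach(2)[OF *(2)] by (meson rtrancl_trans)
  then show ?thesis using noncycle_connected_imp_eq cycle_vertex_reach(1) * by blast
qed

text \<open>Following a walk in \<open>G\<close> from one end of the bridge, every vertex stays reachable from one of the two ends
  without the bridge. The cycle is connected without \<open>f\<close>, so it lies on one side; \<open>x\<close> names the end on that
  side.\<close>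

lemma bridge_components:
  assumes f: "f \<in> edges G" "f \<notin> edges C"
  obtains x y where "f = {x, y}" "x \<noteq> y"
    "comp_with_cycle G C f = {w \<in> verts G. (x, w) \<in> (adj (del_edge G f))\<^sup>*}"
    "comp_without_cycle G C f = {w \<in> verts G. (y, w) \<in> (adj (del_edge G f))\<^sup>*}"
    "comp_with_cycle G C f \<inter> comp_without_cycle G C f = {}"
    "comp_with_cycle G C f \<union> comp_without_cycle G C f = verts G"
proof -
  let ?T = "del_edge G f"
  let ?K = "\<lambda>x. {w \<in> verts G. (x, w) \<in> (adj ?T)\<^sup>*}"
  obtain p where p: "lists_cycle p C" using some_listing by blast
  obtain a b where ab: "f = {a, b}" "a \<noteq> b" using edge_ends f by blast
  have abV: "a \<in> verts G" "b \<in> verts G" using f ab simple by (auto simp: simple_graph_def)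
  have nab: "(a, b) \<notin> (adj ?T)\<^sup>*" using noncycle_edge_bridge f ab by metis
  have cover: "(a, w) \<in> (adj ?T)\<^sup>* \<or> (b, w) \<in> (adj ?T)\<^sup>*" if "w \<in> verts G" for w
  proof -
    have "(a, w) \<in> (adj G)\<^sup>*" using that abV connected by (auto simp: connected_graph_def)
    then show ?thesis
    proof (induction rule: rtrancl_induct)
      case (step v w)
      show ?case
      proof (cases "{v, w} = f")
        case True
        then show ?thesis using ab by (auto simp: doubleton_eq_iff)
      next
        case False
        then have "(v, w) \<in> adj ?T" using step by (simp add: adj_del_edge)
        then show ?thesis using step.IH by (meson rtrancl.rtrancl_into_rtrancl)
      qed
    qed simp
  qed
  have same: "?K v = ?K x" if "(x, v) \<in> (adj ?T)\<^sup>*" for x v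
    using that by (auto intro: rtrancl_trans connected_sym dest: connected_sym)
  have comps: "components_of ?T = {?K a, ?K b}"
  proof
    show "components_of ?T \<subseteq> {?K a, ?K b}"
    proof
      fix K assume "K \<in> components_of ?T"
      then obtain v where v: "v \<in> verts G" "K = ?K v" unfolding components_of_def by auto
      from cover[OF v(1)] show "K \<in> {?K a, ?K b}"
      proof
        assume "(a, v) \<in> (adj ?T)\<^sup>*"
        from same[OF this] v show ?thesis by simp
      next
        assume "(b, v) \<in> (adj ?T)\<^sup>*"
        from same[OF this] v show ?thesis by simp
      qed
    qed
    show "{?K a, ?K b} \<subseteq> components_of ?T"
      using abV unfolding components_of_def by auto
  qed
  have disj: "?K a \<inter> ?K b = {}"
    using nab by (auto dest: connected_sym intro: rtrancl_trans)
  have "f \<notin> edges C" using f by simp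
  then have EC: "edges C \<subseteq> edges ?T" using cycle_edges by auto
  obtain c where c: "c \<in> verts C" using cycle_len(2) by fastforce
  then have cV: "c \<in> verts G" using sub by (auto simp: subgraph_def)
  have CK: "verts C \<subseteq> ?K x" if "(x, c) \<in> (adj ?T)\<^sup>*" for x
    using cycle_connected[OF p EC c] that sub by (auto simp: subgraph_def intro: rtrancl_trans)
  obtain x y where xy: "f = {x, y}" "x \<noteq> y" "components_of ?T = {?K x, ?K y}" "?K x \<inter> ?K y = {}"
    and xc: "(x, c) \<in> (adj ?T)\<^sup>*" and un: "?K x \<union> ?K y = verts G"
  proof (cases "(a, c) \<in> (adj ?T)\<^sup>*")
    case True
    then show thesis using that[of a b] ab comps disj cover by auto
  next
    case False
    then have "(b, c) \<in> (adj ?T)\<^sup>*" using cover cV by blast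
    moreover have "f = {b, a}" using ab(1) by (simp add: insert_commute)
    moreover have "components_of ?T = {?K b, ?K a}" using comps by (simp add: insert_commute)
    moreover have "?K b \<inter> ?K a = {}" using disj by (simp add: Int_commute)
    moreover have "?K b \<union> ?K a = verts G" using cover by auto
    ultimately show thesis using that[of b a] ab(2) by simp
  qed
  have nC: "\<not> verts C \<subseteq> ?K y" using xy(4) CK[OF xc] c by blast
  have "comp_with_cycle G C f = ?K x"
    unfolding comp_with_cycle_def using xy(3) CK[OF xc] nC by (intro the_equality) auto
  moreover have "comp_without_cycle G C f = ?K y"
    unfolding comp_without_cycle_def using xy(3) CK[OF xc] nC by (intro the_equality) auto
  ultimately show thesis using that[OF xy(1,2)] xy(4) un by simp
qed

text \<open>From a vertex on the side of \<open>x\<close>, the other end \<open>y\<close> is strictly farther: otherwise a shortest walk to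
  \<open>y\<close> would avoid the bridge.\<close>

lemma bridge_edge_dist:
  assumes f: "{x, y} \<in> edges G" "{x, y} \<notin> edges C"
    and j: "(x, j) \<in> (adj (del_edge G {x, y}))\<^sup>*"
  shows "edge_dist G {x, y} j = gdist G j x"
proof -
  have "(x, j) \<in> (adj G)\<^sup>*"
    using rtrancl_mono[of "adj (del_edge G {x, y})" "adj G"] j by (fastforce simp: adj_del_edge)
  then have jx: "(j, x) \<in> (adj G)\<^sup>*" by (rule connected_sym)
  have "(x, y) \<in> adj G" using f by (simp add: adj_def)
  with jx have jy: "(j, y) \<in> (adj G)\<^sup>*" by (rule rtrancl.rtrancl_into_rtrancl)
  have "gdist G j x < gdist G j y"
  proof (rule ccontr)
    assume "\<not> gdist G j x < gdist G j y"
    then have "(j, y) \<in> (adj (del_edge G {x, y}))\<^sup>*"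
      by (intro nearer_endpoint_avoids_edge[OF jy]) simp
    with j have "(x, y) \<in> (adj (del_edge G {x, y}))\<^sup>*" by (rule rtrancl_trans)
    with noncycle_edge_bridge[OF f] show False by simp
  qed
  then show ?thesis unfolding edge_dist_def by simp
qed

end

section \<open>The matrix \<open>H\<close>\<close>

lemma walk_sign:
  assumes "\<And>u v. (u, v) \<in> R \<Longrightarrow> s v = - (s u :: real)" "(u, v) \<in> R ^^ k"
  shows "s v = (- 1) ^ k * s u"
  using assms(2) by (induction k arbitrary: v) (auto dest: assms(1))

lemma sum_mult_indicator:
  "(\<Sum>j\<in>UNIV. f j * (if j \<in> A then 1 else 0)) = (\<Sum>j\<in>A. f j :: real)"
  for A :: "'a::finite set"
  by (intro sum.mono_neutral_cong_right) auto

text \<open>The assumption \<open>s u * s u = 1\<close> encodes \<open>s u = \<plusminus>1\<close> in the form in which the signs cancel in sums.\<close>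

locale indexed_even_unicyclic = even_unicyclic G C
  for G C :: "'n::finite ugraph" +
  fixes e :: "'n \<Rightarrow> 'n set" and r :: "'n \<Rightarrow> 'n" and s :: "'n \<Rightarrow> real"
  assumes verts_UNIV: "verts G = UNIV"
    and bij_e: "bij_betw e UNIV (edges G)"
    and r_end: "\<And>i. e i \<in> edges C \<Longrightarrow> r i \<in> e i"
    and s_sq: "\<And>u. s u * s u = 1"
    and s_flip: "\<And>u v. (u, v) \<in> adj G \<Longrightarrow> s v = - s u"
begin

abbreviation "M \<equiv> incidence_matrix e"
abbreviation "H \<equiv> H_matrix G C e r"
abbreviation "L \<equiv> card (verts C)"
abbreviation "T i \<equiv> del_edge G (e i)"

lemma e_edge: "e i \<in> edges G"
  using bij_e by (auto simp: bij_betw_def)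

lemma e_eq_iff: "e i = e k \<longleftrightarrow> i = k"
  using bij_e by (auto simp: bij_betw_def inj_eq)

lemma e_surj: "f \<in> edges G \<Longrightarrow> \<exists>k. e k = f"
  using bij_e by (metis bij_betw_def rangeE)

lemma e_ends: obtains u v where "e k = {u, v}" "u \<noteq> v" "(u, v) \<in> adj G" "s v = - s u"
  using edge_ends[OF e_edge[of k]] e_edge[of k] s_flip that by (fastforce simp: adj_def)

lemma card_pos: "real (card (verts G)) > 0" "real L > 0"
  using cycle_len(2) by (auto simp: verts_UNIV card_gt_0_iff)

lemma nonempty [simp]: "verts C \<noteq> {}" "verts G \<noteq> {}"
proof -
  show "verts C \<noteq> {}"
  proof
    assume "verts C = {}"
    then show False using cycle_len(2) by simp
  qed
qed (simp add: verts_UNIV)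

lemma odd_pred_L: "odd (L - 1)"
  using cycle_len by simp

lemma row_times_M:
  assumes "e k = {u, v}" "u \<noteq> v"
  shows "(\<Sum>j\<in>UNIV. x j * M $ j $ k) = x u + x v"
  using assms(2) by (simp only: incidence_matrix_def vec_lambda_beta sum_mult_indicator assms(1)) simp

lemma HM_entry:
  assumes "e k = {u, v}" "u \<noteq> v"
  shows "(H ** M) $ i $ k = H $ i $ u + H $ i $ v"
  using row_times_M[OF assms, of "\<lambda>j. H $ i $ j"] by (simp add: matrix_matrix_mult_def)

lemma gdist_sign:
  assumes "(u, v) \<in> (adj F)\<^sup>*" "adj F \<subseteq> adj G"
  shows "(- 1) ^ gdist F u v = s u * s v"
proof -
  have "s v = (- 1) ^ gdist F u v * s u"
    using assms by (intro walk_sign[of "adj F"] gdist_walk) (auto intro: s_flip)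
  then have "s u * s v = (- 1) ^ gdist F u v * (s u * s u)" by (simp add: ac_simps)
  then show ?thesis by (simp add: s_sq)
qed

text \<open>Both signs \<open>(-1)\<^sup>d\<close> are expressed through the colour of the end \<open>x\<close> on the cycle side. On the other
  side the nearest end is \<open>y\<close>, which has the opposite colour; hence the minus sign there.\<close>

lemma bridge_row:
  assumes i: "e i \<notin> edges C"
  obtains x y K K' where "e i = {x, y}" "x \<noteq> y" "x \<in> K" "y \<in> K'" "K \<inter> K' = {}" "K \<union> K' = UNIV"
    "\<And>u v. (u, v) \<in> adj (T i) \<Longrightarrow> u \<in> K \<longleftrightarrow> v \<in> K"
    "\<And>j. H $ i $ j = s x * s j * (if j \<in> K then real (card K') else - real (card K)) / real (card (verts G))"
proof -
  let ?K = "comp_with_cycle G C (e i)" and ?K' = "comp_without_cycle G C (e i)"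
  obtain x y where xy: "e i = {x, y}" "x \<noteq> y"
    and K: "?K = {w \<in> verts G. (x, w) \<in> (adj (T i))\<^sup>*}"
    and K': "?K' = {w \<in> verts G. (y, w) \<in> (adj (T i))\<^sup>*}"
    and part: "?K \<inter> ?K' = {}" "?K \<union> ?K' = verts G"
    using bridge_components[OF e_edge i] by blast
  have sub: "adj (T i) \<subseteq> adj G" by (auto simp: adj_del_edge)
  have xyG: "{x, y} \<in> edges G" "{x, y} \<notin> edges C" "{y, x} \<in> edges G" "{y, x} \<notin> edges C"
    using e_edge[of i] i xy by (auto simp: insert_commute)
  have sy: "s y = - s x" using xyG by (intro s_flip) (simp add: adj_def)
  have con: "(u, v) \<in> (adj G)\<^sup>*" for u v
    using connected by (simp add: connected_graph_def verts_UNIV)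
  have sgn: "(- 1) ^ edge_dist G (e i) j = (if j \<in> ?K then s x * s j else - (s x * s j))" for j
  proof (cases "j \<in> ?K")
    case True
    then have "edge_dist G (e i) j = gdist G j x"
      using bridge_edge_dist[OF xyG(1,2), of j] unfolding K xy(1)[symmetric] by simp
    then show ?thesis using True gdist_sign[OF con, of j x] by simp
  next
    case False
    then have "j \<in> ?K'" using part verts_UNIV by blast
    then have "edge_dist G (e i) j = gdist G j y"
      using bridge_edge_dist[OF xyG(3,4), of j] unfolding K' insert_commute[of y] xy(1)[symmetric] by simp
    then show ?thesis using False gdist_sign[OF con, of j y] by (simp add: sy)
  qed
  have row: "H $ i $ j = s x * s j * (if j \<in> ?K then real (card ?K') else - real (card ?K)) / real (card (verts G))" for j
  proof -
    have "j \<in> ?K' \<longleftrightarrow> j \<notin> ?K" using part verts_UNIV by blast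
    then show ?thesis
      using i card_pos by (simp add: H_matrix_def sgn)
  qed
  have "u \<in> ?K \<longleftrightarrow> v \<in> ?K" if "(u, v) \<in> adj (T i)" for u v
  proof -
    have "(u, v) \<in> (adj (T i))\<^sup>*" using that by blast
    then show ?thesis unfolding K verts_UNIV by (auto intro: rtrancl_trans dest: connected_sym)
  qed
  moreover have "x \<in> ?K" "y \<in> ?K'" by (auto simp: K K' verts_UNIV)
  ultimately show thesis using that[OF xy] part row verts_UNIV by metis
qed

lemma cycle_row:
  assumes i: "e i \<in> edges C"
  shows "H $ i $ j = s (r i) * s j *
     ((\<Sum>t\<in>verts C. real (branch_size G C t) * real (gdist (T i) (r i) t))
      - real (card (verts G)) * real (gdist (T i) (r i) (cycle_vertex G C j)))
     / (real (card (verts G)) * real L)"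
proof -
  have "(r i, j) \<in> (adj (T i))\<^sup>*"
    using del_cycle_edge_connected[OF i] by (simp add: verts_UNIV)
  then have "(- 1) ^ gdist (T i) (r i) j = s (r i) * s j"
    by (rule gdist_sign) (auto simp: adj_del_edge)
  then show ?thesis using i by (simp add: H_matrix_def)
qed

text \<open>On a cycle row, grouping the vertices \<open>j\<close> by \<open>j\<^sup>*\<close> turns the sum of the distances \<open>d(r i, j\<^sup>*)\<close> into the
  weighted sum of \<open>d(r i, t)\<close> with weights \<open>n\<^sub>t\<close>, so the constant term balances the other one. On a bridge
  row each side contributes the product of the two component sizes, with opposite signs.\<close>

lemma H_colouring_zero: "(\<Sum>j\<in>UNIV. H $ i $ j * s j) = 0"
proof (cases "e i \<in> edges C")
  case True
  let ?n = "real (card (verts G))"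
  let ?d = "\<lambda>t. real (gdist (T i) (r i) t)"
  let ?c = "\<Sum>t\<in>verts C. real (branch_size G C t) * ?d t"
  have "?c = (\<Sum>t\<in>verts C. \<Sum>j\<in>{j\<in>UNIV. cycle_vertex G C j = t}. ?d (cycle_vertex G C j))"
    by (intro sum.cong) (auto simp: branch_size_def verts_UNIV)
  also have "\<dots> = (\<Sum>j\<in>UNIV. ?d (cycle_vertex G C j))"
    by (intro sum.group) (auto simp: cycle_vertex_reach(1) verts_UNIV)
  finally have c: "?c = (\<Sum>j\<in>UNIV. ?d (cycle_vertex G C j))" .
  have summand: "H $ i $ j * s j = s (r i) / (?n * real L) * (?c - ?n * ?d (cycle_vertex G C j))" for j
  proof -
    have "H $ i $ j * s j = (s j * s j) * s (r i) / (?n * real L) * (?c - ?n * ?d (cycle_vertex G C j))"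
      unfolding cycle_row[OF True] by (simp add: field_simps)
    then show ?thesis by (simp add: s_sq)
  qed
  have "(\<Sum>j\<in>UNIV. ?c - ?n * ?d (cycle_vertex G C j)) = 0"
    by (simp add: sum_subtractf c verts_UNIV flip: sum_distrib_left)
  then show ?thesis unfolding summand sum_distrib_left[symmetric] by simp
next
  case False
  let ?n = "real (card (verts G))"
  obtain x y K K' where K: "K \<inter> K' = {}" "K \<union> K' = UNIV"
    and row: "\<And>j. H $ i $ j = s x * s j * (if j \<in> K then real (card K') else - real (card K)) / ?n"
    using bridge_row[OF False] by metis
  have summand: "H $ i $ j * s j = s x / ?n * (if j \<in> K then real (card K') else - real (card K))" for j
  proof -
    have "H $ i $ j * s j = (s j * s j) * s x / ?n * (if j \<in> K then real (card K') else - real (card K))"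
      unfolding row by simp
    then show ?thesis by (simp add: s_sq)
  qed
  have "- K = K'" using K by blast
  then have "(\<Sum>j\<in>UNIV. if j \<in> K then real (card K') else - real (card K)) = 0"
    by (simp add: sum.If_cases)
  then show ?thesis unfolding summand sum_distrib_left[symmetric] by simp
qed

lemma HM_bridge_row:
  assumes i: "e i \<notin> edges C"
  shows "(H ** M) $ i $ k = (if i = k then 1 else 0)"
proof -
  let ?n = "real (card (verts G))"
  obtain x y K K' where xy: "e i = {x, y}" "x \<noteq> y" "x \<in> K" "y \<in> K'" and K: "K \<inter> K' = {}" "K \<union> K' = UNIV"
    and cut: "\<And>u v. (u, v) \<in> adj (T i) \<Longrightarrow> u \<in> K \<longleftrightarrow> v \<in> K"
    and row: "\<And>j. H $ i $ j = s x * s j * (if j \<in> K then real (card K') else - real (card K)) / ?n"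
    using bridge_row[OF i] by blast
  show ?thesis
  proof (cases "i = k")
    case True
    have "(x, y) \<in> adj G" using xy e_edge[of i] by (simp add: adj_def)
    then have sy: "s y = - s x" by (rule s_flip)
    have "card K + card K' = card (verts G)"
      unfolding verts_UNIV K(2)[symmetric] using K(1) by (intro card_Un_disjoint[symmetric]) auto
    then have n: "real (card K) + real (card K') = ?n" by linarith
    have "y \<notin> K" using xy K by blast
    have "(H ** M) $ i $ k = H $ i $ x + H $ i $ y"
      using HM_entry[of k x y i] xy True by simp
    also have "\<dots> = s x * s x * (real (card K) + real (card K')) / ?n"
      using \<open>y \<notin> K\<close> \<open>x \<in> K\<close> by (simp add: row sy distrib_left add_divide_distrib mult.assoc)
    finally show ?thesis using True card_pos by (simp add: s_sq n)
  next
    case False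
    obtain u v where uv: "e k = {u, v}" "u \<noteq> v" "(u, v) \<in> adj G" "s v = - s u" by (rule e_ends)
    have "{u, v} \<noteq> e i" using uv False e_eq_iff by metis
    then have "u \<in> K \<longleftrightarrow> v \<in> K" using uv by (intro cut) (simp add: adj_del_edge)
    then show ?thesis using False by (simp add: HM_entry[OF uv(1,2)] row uv(4))
  qed
qed

lemma HM_bridge_column:
  assumes "e i \<in> edges C" "e k \<notin> edges C"
  shows "(H ** M) $ i $ k = 0"
proof -
  obtain u v where uv: "e k = {u, v}" "u \<noteq> v" "(u, v) \<in> adj G" "s v = - s u" by (rule e_ends)
  have "cycle_vertex G C u = cycle_vertex G C v"
    using uv assms by (intro cycle_vertex_noncycle_edge) auto
  then show ?thesis by (simp add: HM_entry[OF uv(1,2)] cycle_row[OF assms(1)] uv(4))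
qed

text \<open>The scaling by \<open>|C|\<close> makes the nonzero entries of \<open>H M - I\<close> equal to \<open>\<plusminus>1\<close>.\<close>

definition dev :: "'n \<Rightarrow> 'n \<Rightarrow> real" where
  "dev i k = real L * ((H ** M) $ i $ k - (if i = k then 1 else 0))"

lemma dev_bridge: "e i \<notin> edges C \<or> e k \<notin> edges C \<Longrightarrow> dev i k = 0"
  using HM_bridge_row[of i k] HM_bridge_column[of i k] unfolding dev_def
  by (cases "e i \<in> edges C") (auto simp del: mult_eq_0_iff)

text \<open>List \<open>C\<close> from \<open>r i\<close> so that \<open>e i\<close> is the closing edge. The vertex at position \<open>m\<close> has distance \<open>m\<close> from
  \<open>r i\<close> and colour \<open>(-1)\<^sup>m s (r i)\<close>, so the edge at position \<open>m\<close> sees a difference \<open>n\<close> with sign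
  \<open>(-1)\<^sup>m\<close>. The closing edge gives \<open>(|C| - 1) / |C|\<close>, which is \<open>1\<close> minus \<open>1 / |C|\<close>; as \<open>|C| - 1\<close> is
  odd, it continues the alternation.\<close>

lemma dev_cycle:
  assumes i: "e i \<in> edges C"
  obtains q where "lists_cycle q C" "cyc_edge q (L - 1) = e i"
    "\<And>m k. m < L \<Longrightarrow> e k = cyc_edge q m \<Longrightarrow> dev i k = (- 1) ^ m"
proof -
  let ?n = "real (card (verts G))" and ?r = "r i"
  obtain t where t: "e i = {?r, t}" using edge_ends[OF e_edge[of i]] r_end[OF i] by (auto simp: insert_commute)
  obtain q where q: "lists_cycle q C" "q ! 0 = ?r" "q ! (length q - 1) = t"
    and d': "\<And>m. m < length q \<Longrightarrow> gdist (T i) ?r (q ! m) = m"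
    using cycle_listing[of ?r t] i t by metis
  have len: "length q = L" using lists_cycle_card(1)[OF q(1)] by simp
  note L = cycle_len
  have last: "cyc_edge q (L - 1) = e i"
  proof -
    have "Suc (L - 1) = L" using L by linarith
    then show ?thesis using q t len by (simp add: cyc_edge_def insert_commute)
  qed
  have sgn: "s ?r * s (q ! m) = (- 1) ^ m" if "m < L" for m
  proof -
    have "(?r, q ! m) \<in> (adj (T i))\<^sup>*"
      using del_cycle_edge_connected[OF i] by (simp add: verts_UNIV)
    then have "(- 1) ^ gdist (T i) ?r (q ! m) = s ?r * s (q ! m)"
      by (rule gdist_sign) (auto simp: adj_del_edge)
    then show ?thesis using d'[of m] that len by simp
  qed
  obtain c where c: "\<And>m. m < L \<Longrightarrow> H $ i $ (q ! m) = (- 1) ^ m * (c - ?n * real m) / (?n * real L)"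
  proof
    fix m assume m: "m < L"
    then have "q ! m \<in> verts C" using q(1) len by (auto simp: lists_cycle_def)
    then show "H $ i $ (q ! m) = (- 1) ^ m *
       ((\<Sum>t\<in>verts C. real (branch_size G C t) * real (gdist (T i) (r i) t)) - ?n * real m) / (?n * real L)"
      using m d'[of m] len by (simp add: cycle_row[OF i] cycle_vertex_cycle sgn)
  qed
  have "dev i k = (- 1) ^ m" if m: "m < L" and k: "e k = cyc_edge q m" for m k
  proof (cases "m = L - 1")
    case True
    then have ik: "i = k" using k last e_eq_iff by metis
    have od: "odd m" using True odd_pred_L by simp
    have "e k = {q ! m, q ! 0}" using last t q True len ik by (simp add: insert_commute)
    moreover have "q ! m \<noteq> q ! 0"
      using q(1) True L len by (auto simp: lists_cycle_def nth_eq_iff_index_eq)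
    ultimately have "(H ** M) $ i $ k = H $ i $ (q ! m) + H $ i $ (q ! 0)" by (rule HM_entry)
    also have "H $ i $ (q ! m) = (?n * real m - c) / (?n * real L)" using c[OF m] od by simp
    also have "H $ i $ (q ! 0) = c / (?n * real L)" using c[of 0] card_pos by simp
    also have "(?n * real m - c) / (?n * real L) + c / (?n * real L) = real m / real L"
      using card_pos by (simp add: diff_divide_distrib)
    also have "real m = real L - 1" using True L by (simp add: of_nat_diff)
    finally show ?thesis using ik od card_pos by (simp add: dev_def field_simps)
  next
    case False
    then have Sm: "Suc m < L" using m by linarith
    have "cyc_edge q m \<noteq> cyc_edge q (L - 1)"
      using inj_on_cyc_edge[of q] q(1) len m False by (auto simp: lists_cycle_def inj_on_def)
    then have ik: "i \<noteq> k" using k last by auto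
    have "e k = {q ! m, q ! Suc m}" using k Sm len by (simp add: cyc_edge_def)
    moreover have "q ! m \<noteq> q ! Suc m"
      using q(1) Sm len by (auto simp: lists_cycle_def nth_eq_iff_index_eq)
    ultimately have "(H ** M) $ i $ k = H $ i $ (q ! m) + H $ i $ (q ! Suc m)" by (rule HM_entry)
    also have "\<dots> = (- 1) ^ m / real L"
      unfolding c[OF m] c[OF Sm] using card_pos by (simp add: field_simps)
    finally show ?thesis using ik card_pos by (simp add: dev_def)
  qed
  with q(1) last that show thesis by blast
qed

text \<open>For a vector supported on the cycle edges, only the two cycle edges at a cycle vertex contribute. The index
  is shifted by one, to name the preceding edge without truncated subtraction.\<close>

lemma M_row_cycle_vertex:
  assumes q: "lists_cycle q C" and x: "\<And>k. e k \<notin> edges C \<Longrightarrow> x k = 0"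
    and \<kappa>: "\<And>m. m < L \<Longrightarrow> e (\<kappa> m) = cyc_edge q m" and a: "a < L"
  shows "(\<Sum>k\<in>UNIV. M $ (q ! (Suc a mod L)) $ k * x k) = x (\<kappa> a) + x (\<kappa> (Suc a mod L))"
proof -
  let ?b = "Suc a mod L" and ?j = "q ! (Suc a mod L)"
  have len: "length q = L" using lists_cycle_card(1)[OF q] by simp
  have b: "?b < L" using a by (intro mod_less_divisor) linarith
  have ab: "a \<noteq> ?b" using mod_Suc_neq[OF cycle_len(2) a] by simp
  have inj: "inj_on (cyc_edge q) {..<L}" 
    using inj_on_cyc_edge[of q] q unfolding lists_cycle_def len by blast
  have incident: "m = a \<or> m = ?b" if "?j \<in> cyc_edge q m" "m < L" for m
  proof -
    have Sm: "Suc m mod L < L" using a by (intro mod_less_divisor) linarith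
    have "?b = m \<or> ?b = Suc m mod L"
      using that q b Sm len by (auto simp: cyc_edge_def lists_cycle_def nth_eq_iff_index_eq)
    moreover have "Suc a mod L = Suc m mod L \<Longrightarrow> a = m"
      using a that(2) by (auto simp: mod_Suc split: if_splits)
    ultimately show ?thesis by blast
  qed
  have "M $ ?j $ k * x k = 0" if k: "k \<notin> {\<kappa> a, \<kappa> ?b}" for k
  proof (cases "e k \<in> edges C")
    case True
    then obtain m where m: "m < L" "e k = cyc_edge q m" using q len by (auto simp: lists_cycle_def)
    then have "k = \<kappa> m" using \<kappa> e_eq_iff by metis
    then have "?j \<notin> e k" using incident m k by auto
    then show ?thesis by (simp add: incidence_matrix_def)
  qed (simp add: x)
  then have "(\<Sum>k\<in>UNIV. M $ ?j $ k * x k) = (\<Sum>k\<in>{\<kappa> a, \<kappa> ?b}. M $ ?j $ k * x k)"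
    by (intro sum.mono_neutral_right) auto
  moreover have "\<kappa> a \<noteq> \<kappa> ?b"
    using inj ab a b \<kappa>[OF a] \<kappa>[OF b] by (auto simp: inj_on_def)
  moreover have "?j \<in> e (\<kappa> a)" "?j \<in> e (\<kappa> ?b)"
    using \<kappa>[OF a] \<kappa>[OF b] len by (auto simp: cyc_edge_def)
  ultimately show ?thesis by (simp add: incidence_matrix_def)
qed

lemma cycle_vertex_position:
  assumes "lists_cycle q C" "j \<in> verts C"
  obtains a where "a < L" "j = q ! (Suc a mod L)"
proof -
  have len: "length q = L" using lists_cycle_card(1)[OF assms(1)] by simp
  obtain m where m: "m < L" "j = q ! m"
    using assms len by (auto simp: lists_cycle_def in_set_conv_nth)
  show thesis
  proof (cases m)
    case 0
    then show ?thesis using that[of "L - 1"] m by simp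
  next
    case (Suc a)
    then show ?thesis using that[of a] m by simp
  qed
qed

lemma cycle_index:
  assumes "lists_cycle q C"
  obtains \<kappa> where "\<And>m. m < L \<Longrightarrow> e (\<kappa> m) = cyc_edge q m"
proof
  fix m assume "m < L"
  then have "cyc_edge q m \<in> edges G"
    using assms cycle_edges lists_cycle_card(1)[OF assms] by (auto simp: lists_cycle_def)
  then show "e (inv e (cyc_edge q m)) = cyc_edge q m"
    using bij_e by (intro f_inv_into_f) (simp add: bij_betw_def)
qed

text \<open>The two cycle edges at a cycle vertex carry opposite signs. At the vertex where the listing starts this
  needs that \<open>|C|\<close> is even.\<close>

lemma dev_kernel: "(\<Sum>k\<in>UNIV. M $ j $ k * dev i k) = 0"
proof (cases "e i \<in> edges C \<and> j \<in> verts C")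
  case True
  obtain q where q: "lists_cycle q C"
    and w: "\<And>m k. m < L \<Longrightarrow> e k = cyc_edge q m \<Longrightarrow> dev i k = (- 1) ^ m"
    using dev_cycle True by metis
  obtain \<kappa> where \<kappa>: "\<And>m. m < L \<Longrightarrow> e (\<kappa> m) = cyc_edge q m"
    using cycle_index[OF q] by metis
  obtain a where a: "a < L" "j = q ! (Suc a mod L)"
    using cycle_vertex_position[OF q] True by metis
  have b: "Suc a mod L < L" using a by (intro mod_less_divisor) linarith
  have "(\<Sum>k\<in>UNIV. M $ j $ k * dev i k) = dev i (\<kappa> a) + dev i (\<kappa> (Suc a mod L))"
    unfolding a(2) using dev_bridge by (intro M_row_cycle_vertex[OF q _ \<kappa> a(1)]) auto
  also have "\<dots> = (- 1) ^ a + (- 1) ^ (Suc a mod L)"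
    using w[OF a(1) \<kappa>] w[OF b \<kappa>] a b by simp
  also have "\<dots> = 0"
  proof (cases "Suc a = L")
    case True
    then have "odd a" using cycle_len(1) by (metis even_Suc)
    then show ?thesis using True by simp
  next
    case False
    then have "Suc a < L" using a by simp
    then show ?thesis by simp
  qed
  finally show ?thesis .
next
  case False
  have "M $ j $ k * dev i k = 0" for k
  proof (cases "e i \<in> edges C \<and> e k \<in> edges C")
    case True
    then have "j \<notin> e k" using False cycle_edge_verts by blast
    then show ?thesis by (simp add: incidence_matrix_def)
  qed (auto simp: dev_bridge)
  then show ?thesis by (intro sum.neutral) blast
qed

text \<open>Row \<open>k\<close> is in the kernel of \<open>M\<close> and supported on the cycle, so it alternates along the listing for row
  \<open>i\<close>, and is therefore a multiple of row \<open>i\<close>. Both rows are \<open>-1\<close> on the diagonal, which determines the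
  factor.\<close>

lemma dev_sym: "dev i k = dev k i"
proof (cases "e i \<in> edges C \<and> e k \<in> edges C")
  case True
  obtain q where q: "lists_cycle q C" and last: "cyc_edge q (L - 1) = e i"
    and w: "\<And>m k. m < L \<Longrightarrow> e k = cyc_edge q m \<Longrightarrow> dev i k = (- 1) ^ m"
    using dev_cycle True by metis
  have len: "length q = L" using lists_cycle_card(1)[OF q] by simp
  obtain \<kappa> where \<kappa>: "\<And>m. m < L \<Longrightarrow> e (\<kappa> m) = cyc_edge q m"
    using cycle_index[OF q] by metis
  have diag: "dev k k = - 1"
  proof -
    obtain q' where q': "cyc_edge q' (L - 1) = e k"
      "\<And>m k'. m < L \<Longrightarrow> e k' = cyc_edge q' m \<Longrightarrow> dev k k' = (- 1) ^ m"
      using dev_cycle True by metis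
    have "dev k k = (- 1) ^ (L - 1)" using q' card_pos by simp
    then show ?thesis using odd_pred_L by simp
  qed
  have alt: "dev k (\<kappa> m) = (- 1) ^ m * dev k (\<kappa> 0)" if "m < L" for m
    using that
  proof (induction m)
    case (Suc m)
    have "dev k (\<kappa> m) + dev k (\<kappa> (Suc m mod L)) = 0"
      using M_row_cycle_vertex[OF q _ \<kappa>, of "dev k" m] dev_bridge dev_kernel Suc.prems by simp
    then show ?case using Suc by simp
  qed simp
  have "\<kappa> (L - 1) = i" using \<kappa>[of "L - 1"] last e_eq_iff card_pos by auto
  then have ki: "dev k i = - dev k (\<kappa> 0)" using alt[of "L - 1"] card_pos odd_pred_L by simp
  obtain m where m: "m < L" "e k = cyc_edge q m" using True q len by (auto simp: lists_cycle_def)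
  then have "\<kappa> m = k" using \<kappa>[of m] e_eq_iff by metis
  then have "- 1 = (- 1) ^ m * dev k (\<kappa> 0)" using alt[of m] m diag by simp
  then have "dev k (\<kappa> 0) = - ((- 1) ^ m)"
    by (metis minus_minus mult_minus1 mult_minus_right mult_1 minus_one_power_iff)
  then show ?thesis using w[OF m] ki by simp
qed (auto simp: dev_bridge)

lemma HM_eq: "(H ** M) $ i $ k = (if i = k then 1 else 0) + dev i k / real L"
  by (simp add: dev_def)

lemma HM_symmetric: "transpose (H ** M) = H ** M"
  by (simp add: vec_eq_iff transpose_def HM_eq dev_sym)

lemma M_HM: "M ** (H ** M) = M"
proof -
  have "(M ** (H ** M)) $ j $ k = M $ j $ k" for j k
  proof -
    have "(M ** (H ** M)) $ j $ k = (\<Sum>l\<in>UNIV. M $ j $ l * (H ** M) $ l $ k)"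
      by (simp add: matrix_matrix_mult_def)
    also have "\<dots> = (\<Sum>l\<in>UNIV. (if l = k then M $ j $ l else 0) + M $ j $ l * dev k l / real L)"
      by (intro sum.cong) (auto simp: HM_eq dev_sym[of _ k] distrib_left)
    also have "\<dots> = M $ j $ k + (\<Sum>l\<in>UNIV. M $ j $ l * dev k l) / real L"
      by (simp add: sum.distrib sum_divide_distrib)
    finally show ?thesis by (simp add: dev_kernel)
  qed
  then show ?thesis by (simp add: vec_eq_iff)
qed

text \<open>Such a vector is a multiple of \<open>s\<close> by connectedness, so orthogonality to \<open>s\<close> forces it to vanish.\<close>

lemma left_kernel:
  assumes x: "\<And>u v. (u, v) \<in> adj G \<Longrightarrow> x u + x v = 0" and orth: "(\<Sum>j\<in>UNIV. x j * s j) = 0"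
  shows "x j = 0"
proof -
  have const: "x l * s l = x j * s j" for l
  proof -
    have "(j, l) \<in> (adj G)\<^sup>*" using connected by (simp add: connected_graph_def verts_UNIV)
    then show ?thesis
    proof (induction rule: rtrancl_induct)
      case (step u v)
      have "x v = - x u" "s v = - s u" using x[OF step(2)] s_flip[OF step(2)] by linarith+
      then show ?case using step.IH by simp
    qed simp
  qed
  have "(\<Sum>l\<in>UNIV. x l * s l) = (\<Sum>l\<in>(UNIV :: 'n set). x j * s j)"
    by (rule sum.cong[OF refl const])
  then have "x j * s j = 0" using orth by simp
  moreover have "s j \<noteq> 0" using s_sq[of j] by auto
  ultimately show ?thesis by simp
qed

text \<open>The difference \<open>D\<close> of the two sides, as a row vector, satisfies \<open>D M = 0\<close> since \<open>M H M = M\<close> and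
  \<open>s\<^sup>T M = 0\<close>, and \<open>D s = 0\<close> since \<open>H s = 0\<close> and \<open>s\<^sup>T s = n\<close>.\<close>

lemma MH_eq: "(M ** H) $ j $ l = (if j = l then 1 else 0) - s j * s l / real (card (verts G))"
proof -
  let ?n = "real (card (verts G))"
  define D where "D l = (M ** H) $ j $ l - (if j = l then 1 else 0) + s j * s l / ?n" for l
  have MHs: "(\<Sum>l\<in>UNIV. (M ** H) $ j $ l * s l) = 0"
  proof -
    have "(\<Sum>l\<in>UNIV. (M ** H) $ j $ l * s l) = (\<Sum>l\<in>UNIV. \<Sum>i\<in>UNIV. M $ j $ i * (H $ i $ l * s l))"
      by (simp add: matrix_matrix_mult_def sum_distrib_right mult.assoc)
    also have "\<dots> = (\<Sum>i\<in>UNIV. M $ j $ i * (\<Sum>l\<in>UNIV. H $ i $ l * s l))"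
      by (subst sum.swap) (simp add: sum_distrib_left)
    finally show ?thesis by (simp add: H_colouring_zero)
  qed
  have "(\<Sum>l\<in>UNIV. D l * s l) = 0"
  proof -
    have "D l * s l = (M ** H) $ j $ l * s l - (if l = j then s l else 0) + s j / ?n" for l
    proof -
      have "s j * s l / ?n * s l = s j * (s l * s l) / ?n" by simp
      then show ?thesis by (simp add: D_def algebra_simps s_sq)
    qed
    then show ?thesis using card_pos by (simp add: sum.distrib sum_subtractf MHs verts_UNIV)
  qed
  moreover have "D u + D v = 0" if uv: "(u, v) \<in> adj G" for u v
  proof -
    obtain k where k: "e k = {u, v}" using e_surj uv by (auto simp: adj_def)
    have "u \<noteq> v" using s_flip[OF uv] s_sq[of u] by auto
    note * = row_times_M[OF k this]
    have "(M ** H) $ j $ u + (M ** H) $ j $ v = (M ** H ** M) $ j $ k"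
      using *[of "\<lambda>l. (M ** H) $ j $ l"] by (simp add: matrix_matrix_mult_def[of "M ** H"])
    also have "\<dots> = M $ j $ k" by (simp add: M_HM flip: matrix_mul_assoc)
    finally have "(M ** H) $ j $ u + (M ** H) $ j $ v = M $ j $ k" .
    then show ?thesis using \<open>u \<noteq> v\<close> k s_flip[OF uv] by (auto simp: D_def incidence_matrix_def)
  qed
  ultimately have "D l = 0" by (rule left_kernel[rotated])
  then show ?thesis by (simp add: D_def)
qed

lemma MH_symmetric: "transpose (M ** H) = M ** H"
proof -
  have sym: "(M ** H) $ l $ j = (M ** H) $ j $ l" for j l
  proof (cases "j = l")
    case False
    then have "l \<noteq> j" by blast
    with False show ?thesis by (simp add: MH_eq mult.commute)
  qed simp
  show ?thesis unfolding vec_eq_iff transpose_def vec_lambda_beta using sym by blast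
qed

lemma H_MH: "H ** (M ** H) = H"
proof -
  let ?n = "real (card (verts G))"
  have "(H ** (M ** H)) $ i $ l = H $ i $ l" for i l
  proof -
    have "(H ** (M ** H)) $ i $ l = (\<Sum>j\<in>UNIV. H $ i $ j * (M ** H) $ j $ l)"
      by (simp add: matrix_matrix_mult_def[of H])
    also have "\<dots> = (\<Sum>j\<in>UNIV. (if j = l then H $ i $ j else 0) - H $ i $ j * s j * (s l / ?n))"
      by (intro sum.cong) (auto simp: MH_eq right_diff_distrib)
    also have "\<dots> = H $ i $ l - (\<Sum>j\<in>UNIV. H $ i $ j * s j) * (s l / ?n)"
      by (simp only: sum_subtractf sum_distrib_right[symmetric]) simp
    finally show ?thesis by (simp add: H_colouring_zero)
  qed
  then show ?thesis by (simp add: vec_eq_iff)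
qed

lemma moore_penrose: "moore_penrose_inverse M H"
  unfolding moore_penrose_inverse_def matrix_mul_assoc[symmetric]
  by (intro conjI M_HM H_MH HM_symmetric MH_symmetric)

end

theorem theorem2p7:
  fixes G C :: "'n::finite ugraph"
    and e :: "'n \<Rightarrow> 'n set"
    and r :: "'n \<Rightarrow> 'n"
  assumes "even_unicyclic_with_cycle G C"
    and "verts G = UNIV"
    and "bij_betw e UNIV (edges G)"
    and "\<And>i. e i \<in> edges C \<Longrightarrow> r i \<in> e i"
  shows "moore_penrose_inverse (incidence_matrix e) (H_matrix G C e r)"
proof -
  interpret even_unicyclic G C by unfold_locales (rule assms(1))
  show ?thesis
  proof (rule two_colouring)
    fix s :: "'n \<Rightarrow> real"
    assume "\<And>u. s u * s u = 1" "\<And>u v. (u, v) \<in> adj G \<Longrightarrow> s v = - s u"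
    with assms interpret indexed_even_unicyclic G C e r s
      by unfold_locales
    show ?thesis by (rule moore_penrose)
  qed
qed

end
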